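(* In a simple Markov evolution algebra, either all generators are periodic with the same period or all generators are aperiodic.
   Context: A Markov evolution algebra is a real algebra $M$ with a finite nonempty basis $\{e_i\mid i\in\Lambda\}$ (its set of generators) and products $e_i\cdot e_j=0$ for $i\ne j$, $e_i^2=\sum_{k\in\Lambda}p_{ik}e_k$, where $0\le p_{ik}\le 1$ and $\sum_{k\in\Lambda}p_{ik}=1$ for all $i$. Its evolution operator is the linear map $L$ with $L(e_i)=e_i^2$, and for $n\ge1$ the coefficients $n_{ij}$ are defined by $L^n(e_i)=\sum_j n_{ij}e_j$. The period of a generator $e_j$ is the greatest common divisor of the set of integers $n\ge1$ for which $n_{jj}>0$, where $n_{jj}$ is the $j$-th diagonal element of the matrix of $L^n$. A generator with period $1$ is called aperiodic; otherwise it is periodic. An evolution subalgebra is a subalgebra that is the linear span of a subset of the generators; an evolution ideal is an evolution subalgebra $I$ with $M\cdot I\subseteq I$; $M$ is simple if it has no evolution ideals other than $0$ and $M$. *)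

theory Defs
  imports "HOL-Analysis.Linear_Algebra"
begin

text \<open>The algebra is the whole type \<^typ>\<open>'a\<close>, with a bilinear product \<^term>\<open>m\<close> that need not be
  associative. The family \<^term>\<open>e\<close>, indexed by \<^term>\<open>\<Lambda>\<close>, is part of the structure: it is the set of
  generators on which all the notions below depend.\<close>

locale markov_evolution_algebra =
  fixes m :: "'a::real_vector \<Rightarrow> 'a \<Rightarrow> 'a"
    and \<Lambda> :: "'i set"
    and e :: "'i \<Rightarrow> 'a"
    and p :: "'i \<Rightarrow> 'i \<Rightarrow> real"
  assumes bilinear_mult: "bilinear m"
    and finite_index: "finite \<Lambda>"
    and nonempty_index: "\<Lambda> \<noteq> {}"
    and inj_generators: "inj_on e \<Lambda>"
    and independent_generators: "independent (e ` \<Lambda>)"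
    and span_generators: "span (e ` \<Lambda>) = UNIV"
    and mult_distinct: "\<And>i j. i \<in> \<Lambda> \<Longrightarrow> j \<in> \<Lambda> \<Longrightarrow> i \<noteq> j \<Longrightarrow> m (e i) (e j) = 0"
    and mult_same: "\<And>i. i \<in> \<Lambda> \<Longrightarrow> m (e i) (e i) = (\<Sum>k\<in>\<Lambda>. p i k *\<^sub>R e k)"
    and coeff_ge_0: "\<And>i k. i \<in> \<Lambda> \<Longrightarrow> k \<in> \<Lambda> \<Longrightarrow> 0 \<le> p i k"
    and coeff_le_1: "\<And>i k. i \<in> \<Lambda> \<Longrightarrow> k \<in> \<Lambda> \<Longrightarrow> p i k \<le> 1"
    and coeff_sum: "\<And>i. i \<in> \<Lambda> \<Longrightarrow> (\<Sum>k\<in>\<Lambda>. p i k) = 1"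

definition evolution_operator ::
    "('a::real_vector \<Rightarrow> 'a \<Rightarrow> 'a) \<Rightarrow> 'i set \<Rightarrow> ('i \<Rightarrow> 'a) \<Rightarrow> 'a \<Rightarrow> 'a" where
  "evolution_operator m \<Lambda> e = construct (e ` \<Lambda>) (\<lambda>b. m b b)"

lemma (in markov_evolution_algebra) evolution_operator_unique:
  "linear L \<and> (\<forall>i\<in>\<Lambda>. L (e i) = m (e i) (e i)) \<longleftrightarrow> L = evolution_operator m \<Lambda> e"
proof -
  let ?E = "evolution_operator m \<Lambda> e"
  have lin: "linear ?E"
    unfolding evolution_operator_def by (rule linear_construct[OF independent_generators])
  have gen: "?E (e i) = m (e i) (e i)" if "i \<in> \<Lambda>" for i
    unfolding evolution_operator_def
    using construct_basis[OF independent_generators, of "e i" "\<lambda>b. m b b"] that by simp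
  have "L = ?E" if "linear L" "\<forall>i\<in>\<Lambda>. L (e i) = m (e i) (e i)"
  proof
    fix x
    show "L x = ?E x"
      by (rule linear_eq_on[OF that(1) lin, of x "e ` \<Lambda>"]) (use that gen span_generators in auto)
  qed
  then show ?thesis
    using lin gen by blast
qed

text \<open>The coefficient of \<^term>\<open>e j\<close> in the expansion of the \<^term>\<open>n\<close>-th iterate of the evolution
  operator at \<^term>\<open>e i\<close>, i.e. the entry \<open>n\<^sub>i\<^sub>j\<close>.\<close>

definition iterate_coeff ::
    "('a::real_vector \<Rightarrow> 'a \<Rightarrow> 'a) \<Rightarrow> 'i set \<Rightarrow> ('i \<Rightarrow> 'a) \<Rightarrow> nat \<Rightarrow> 'i \<Rightarrow> 'i \<Rightarrow> real" where
  "iterate_coeff m \<Lambda> e n i j =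
     representation (e ` \<Lambda>) ((evolution_operator m \<Lambda> e ^^ n) (e i)) (e j)"

text \<open>If no \<^term>\<open>n\<close> qualifies, the value is \<open>Gcd {} = 0\<close>. In a simple algebra the set is nonempty.\<close>

definition generator_period ::
    "('a::real_vector \<Rightarrow> 'a \<Rightarrow> 'a) \<Rightarrow> 'i set \<Rightarrow> ('i \<Rightarrow> 'a) \<Rightarrow> 'i \<Rightarrow> nat" where
  "generator_period m \<Lambda> e j = Gcd {n. 1 \<le> n \<and> iterate_coeff m \<Lambda> e n j j > 0}"

definition aperiodic_generator ::
    "('a::real_vector \<Rightarrow> 'a \<Rightarrow> 'a) \<Rightarrow> 'i set \<Rightarrow> ('i \<Rightarrow> 'a) \<Rightarrow> 'i \<Rightarrow> bool" where
  "aperiodic_generator m \<Lambda> e j \<longleftrightarrow> generator_period m \<Lambda> e j = 1"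

definition periodic_generator ::
    "('a::real_vector \<Rightarrow> 'a \<Rightarrow> 'a) \<Rightarrow> 'i set \<Rightarrow> ('i \<Rightarrow> 'a) \<Rightarrow> 'i \<Rightarrow> bool" where
  "periodic_generator m \<Lambda> e j \<longleftrightarrow> \<not> aperiodic_generator m \<Lambda> e j"

definition subalgebra :: "('a::real_vector \<Rightarrow> 'a \<Rightarrow> 'a) \<Rightarrow> 'a set \<Rightarrow> bool" where
  "subalgebra m S \<longleftrightarrow> subspace S \<and> (\<forall>x\<in>S. \<forall>y\<in>S. m x y \<in> S)"

definition evolution_subalgebra ::
    "('a::real_vector \<Rightarrow> 'a \<Rightarrow> 'a) \<Rightarrow> 'i set \<Rightarrow> ('i \<Rightarrow> 'a) \<Rightarrow> 'a set \<Rightarrow> bool" where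
  "evolution_subalgebra m \<Lambda> e S \<longleftrightarrow> subalgebra m S \<and> (\<exists>\<Gamma>\<subseteq>\<Lambda>. S = span (e ` \<Gamma>))"

definition evolution_ideal ::
    "('a::real_vector \<Rightarrow> 'a \<Rightarrow> 'a) \<Rightarrow> 'i set \<Rightarrow> ('i \<Rightarrow> 'a) \<Rightarrow> 'a set \<Rightarrow> bool" where
  "evolution_ideal m \<Lambda> e I \<longleftrightarrow> evolution_subalgebra m \<Lambda> e I \<and> (\<forall>x. \<forall>y\<in>I. m x y \<in> I)"

definition simple_evolution_algebra ::
    "('a::real_vector \<Rightarrow> 'a \<Rightarrow> 'a) \<Rightarrow> 'i set \<Rightarrow> ('i \<Rightarrow> 'a) \<Rightarrow> bool" where
  "simple_evolution_algebra m \<Lambda> e \<longleftrightarrow> (\<forall>I. evolution_ideal m \<Lambda> e I \<longrightarrow> I = {0} \<or> I = UNIV)"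

end

theory Submission
  imports Defs
begin

text \<open>
  The numbers \<open>p i k\<close> form a stochastic matrix, and \<open>iterate_coeff m \<Lambda> e n i j\<close> is the entry of its
  \<open>n\<close>-th power, i.e. the \<open>n\<close>-step transition probability from \<open>i\<close> to \<open>j\<close> of a finite Markov chain.
  The theorem is the algebraic form of the fact that the period is a class invariant of a Markov
  chain.

  The algebraic hypothesis enters in one place: the generators reachable from \<open>i\<close> in at
  least one step span a nonzero evolution ideal (\<open>span_forward_closed_ideal\<close>), so simplicity forces
  every generator to be reachable from every other one (\<open>simple_imp_reachable\<close>). The rest is
  arithmetic. If \<open>i\<close> leads to \<open>j\<close> in \<open>a\<close> steps and \<open>j\<close> leads back to \<open>i\<close> in \<open>b\<close> steps, then
  \<open>a + b\<close> is a return time of \<open>i\<close>, and so is \<open>a + n + b\<close> for each return time \<open>n\<close> of \<open>j\<close>; hence the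
  period of \<open>i\<close> divides \<open>n\<close>. Therefore the period of \<open>i\<close> divides that of \<open>j\<close>, and by symmetry the two
  periods agree. The common value is either \<open>1\<close> or not, which is the dichotomy.
\<close>

context markov_evolution_algebra
begin

abbreviation coord :: "'a \<Rightarrow> 'i \<Rightarrow> real" where
  "coord v k \<equiv> representation (e ` \<Lambda>) v (e k)"

abbreviation evol :: "'a \<Rightarrow> 'a" where
  "evol \<equiv> evolution_operator m \<Lambda> e"

abbreviation step :: "nat \<Rightarrow> 'i \<Rightarrow> 'i \<Rightarrow> real" where
  "step \<equiv> iterate_coeff m \<Lambda> e"

lemma linear_evol: "linear evol"
  and evol_generator: "i \<in> \<Lambda> \<Longrightarrow> evol (e i) = (\<Sum>k\<in>\<Lambda>. p i k *\<^sub>R e k)"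
  using evolution_operator_unique[of evol] mult_same by auto

lemma linear_evol_funpow: "linear (evol ^^ n)"
proof (induction n)
  case 0
  show ?case by (simp add: linear_id[unfolded id_def] id_def)
next
  case (Suc n)
  then show ?case using linear_compose[OF Suc linear_evol] by (simp add: o_def)
qed

lemma linear_coord: "linear (\<lambda>v. coord v k)"
  by (rule linearI)
    (simp_all add: real_vector.representation_add real_vector.representation_scale
      independent_generators span_generators)

lemma coord_generator: "i \<in> \<Lambda> \<Longrightarrow> k \<in> \<Lambda> \<Longrightarrow> coord (e i) k = (if i = k then 1 else 0)"
  using inj_generators
  by (auto simp: real_vector.representation_basis independent_generators inj_on_eq_iff)

lemma sum_coord: "(\<Sum>k\<in>\<Lambda>. coord v k *\<^sub>R e k) = v"
  using real_vector.sum_representation_eq[of "e ` \<Lambda>" v "e ` \<Lambda>"]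
  by (simp add: independent_generators span_generators finite_index sum.reindex inj_generators)

lemma linear_functional_expand:
  fixes f :: "'a \<Rightarrow> real"
  assumes "linear f"
  shows "f v = (\<Sum>k\<in>\<Lambda>. coord v k * f (e k))"
  using arg_cong[OF sum_coord[of v], of f]
  by (simp add: linear_sum[OF assms] linear_scale[OF assms])

text \<open>The coordinates of iterates multiply like powers of a matrix, because the \<open>j\<close>-th coordinate
  of \<open>L\<^sup>b\<close> is a linear functional, which is then expanded at \<open>L\<^sup>a e\<^sub>i\<close>.\<close>

lemma chapman_kolmogorov:
  "step (a + b) i j = (\<Sum>k\<in>\<Lambda>. step a i k * step b k j)"
proof -
  have "linear (\<lambda>v. coord ((evol ^^ b) v) j)"
    using linear_compose[OF linear_evol_funpow linear_coord] by (simp add: o_def)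
  then have "coord ((evol ^^ b) ((evol ^^ a) (e i))) j =
      (\<Sum>k\<in>\<Lambda>. coord ((evol ^^ a) (e i)) k * coord ((evol ^^ b) (e k)) j)"
    by (rule linear_functional_expand)
  moreover have "(evol ^^ (a + b)) (e i) = (evol ^^ b) ((evol ^^ a) (e i))"
    by (simp add: add.commute[of a b] funpow_add)
  ultimately show ?thesis
    by (simp add: iterate_coeff_def)
qed

lemma step_Suc_0:
  assumes "i \<in> \<Lambda>" "k \<in> \<Lambda>"
  shows "step (Suc 0) i k = p i k"
proof -
  have "step (Suc 0) i k = (\<Sum>l\<in>\<Lambda>. p i l * coord (e l) k)"
    using assms
    by (simp add: iterate_coeff_def evol_generator linear_sum[OF linear_coord]
        linear_scale[OF linear_coord])
  also have "\<dots> = (\<Sum>l\<in>\<Lambda>. if l = k then p i l else 0)"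
    using assms by (intro sum.cong) (auto simp: coord_generator)
  finally show ?thesis
    using assms finite_index by simp
qed

lemma step_nonneg:
  assumes "i \<in> \<Lambda>" "j \<in> \<Lambda>"
  shows "0 \<le> step n i j"
  using assms
proof (induction n arbitrary: i)
  case 0
  then show ?case by (simp add: iterate_coeff_def coord_generator)
next
  case (Suc n)
  have "step (Suc n) i j = (\<Sum>k\<in>\<Lambda>. step 1 i k * step n k j)"
    using chapman_kolmogorov[of 1 n i j] by simp
  also have "\<dots> \<ge> 0"
    using Suc coeff_ge_0 by (intro sum_nonneg mult_nonneg_nonneg) (auto simp: step_Suc_0)
  finally show ?case .
qed

lemma step_pos_trans:
  assumes "i \<in> \<Lambda>" "k \<in> \<Lambda>" "j \<in> \<Lambda>" "step a i k > 0" "step b k j > 0"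
  shows "step (a + b) i j > 0"
  unfolding chapman_kolmogorov
  using assms finite_index
  by (intro sum_pos2[of \<Lambda> k]) (auto intro: mult_nonneg_nonneg step_nonneg)

text \<open>Since distinct generators annihilate each other, multiplying into the span of \<open>\<Gamma>\<close> only
  produces squares \<open>e\<^sub>k\<^sup>2\<close> with \<open>k \<in> \<Gamma>\<close>. So a span of generators is already an ideal as soon
  as no transition leaves \<open>\<Gamma>\<close>.\<close>

lemma span_forward_closed_ideal:
  assumes sub: "\<Gamma> \<subseteq> \<Lambda>"
    and closed: "\<And>k l. k \<in> \<Gamma> \<Longrightarrow> l \<in> \<Lambda> \<Longrightarrow> p k l > 0 \<Longrightarrow> l \<in> \<Gamma>"
  shows "evolution_ideal m \<Lambda> e (span (e ` \<Gamma>))"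
proof -
  let ?S = "span (e ` \<Gamma>)"
  have square: "m (e k) (e k) \<in> ?S" if k: "k \<in> \<Gamma>" for k
  proof -
    have "p k l *\<^sub>R e l \<in> ?S" if l: "l \<in> \<Lambda>" for l
    proof (cases "p k l = 0")
      case False
      then have "l \<in> \<Gamma>"
        using coeff_ge_0[of k l] closed[OF k l] sub k l by auto
      then show ?thesis by (intro span_scale span_base) auto
    qed (simp add: span_zero)
    then show ?thesis
      using k sub by (subst mult_same) (auto intro: span_sum)
  qed
  have gen: "m (e i) (e k) \<in> ?S" if "i \<in> \<Lambda>" "k \<in> \<Gamma>" for i k
    using square[OF that(2)] mult_distinct[of i k] that sub
    by (cases "i = k") (auto simp: span_zero subset_iff)
  have lin_left: "linear (\<lambda>x. m x y)" and lin_right: "linear (\<lambda>y. m x y)" for x y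
    using bilinear_mult by (auto simp: bilinear_def)
  have right: "m x (e k) \<in> ?S" if k: "k \<in> \<Gamma>" for x k
  proof -
    have "m (\<Sum>i\<in>\<Lambda>. coord x i *\<^sub>R e i) (e k) = (\<Sum>i\<in>\<Lambda>. coord x i *\<^sub>R m (e i) (e k))"
      by (simp add: linear_sum[OF lin_left] linear_scale[OF lin_left])
    also have "\<dots> \<in> ?S"
      using gen k by (intro span_sum span_scale) auto
    finally show ?thesis by (simp add: sum_coord)
  qed
  have "m x y \<in> ?S" if "y \<in> ?S" for x y
    using that
  proof (induction rule: span_induct)
    case base
    then show ?case
      using linear_subspace_vimage[OF lin_right[of x] subspace_span[of "e ` \<Gamma>"]]
      by (simp add: vimage_def)
  next
    case (step y)
    then show ?case using right by auto
  qed
  then show ?thesis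
    using sub by (auto simp: evolution_ideal_def evolution_subalgebra_def subalgebra_def)
qed

lemma generator_in_span_imp_mem:
  assumes "\<Gamma> \<subseteq> \<Lambda>" "j \<in> \<Lambda>" "e j \<in> span (e ` \<Gamma>)"
  shows "j \<in> \<Gamma>"
proof (rule ccontr)
  assume "j \<notin> \<Gamma>"
  then have "e ` \<Gamma> \<subseteq> e ` \<Lambda> - {e j}"
    using assms inj_generators by (auto simp: inj_on_def)
  then have "e j \<in> span (e ` \<Lambda> - {e j})"
    using assms span_mono by blast
  then show False
    using assms independent_generators by (auto simp: dependent_def)
qed

lemma simple_imp_reachable:
  assumes simple: "simple_evolution_algebra m \<Lambda> e"
    and i: "i \<in> \<Lambda>" and j: "j \<in> \<Lambda>"
  obtains n where "n \<ge> 1" "step n i j > 0"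
proof -
  let ?R = "{k \<in> \<Lambda>. \<exists>n\<ge>1. step n i k > 0}"
  have "l \<in> ?R" if k: "k \<in> ?R" and l: "l \<in> \<Lambda>" and "p k l > 0" for k l
  proof -
    obtain n where "n \<ge> 1" "step n i k > 0" using k by auto
    moreover have "step 1 k l > 0" using that by (simp add: step_Suc_0)
    ultimately have "step (n + 1) i l > 0"
      using step_pos_trans i k l by blast
    then show ?thesis using l by auto
  qed
  then have "evolution_ideal m \<Lambda> e (span (e ` ?R))"
    by (intro span_forward_closed_ideal) auto
  then have "span (e ` ?R) = {0} \<or> span (e ` ?R) = UNIV"
    using simple by (simp add: simple_evolution_algebra_def)
  moreover have "span (e ` ?R) \<noteq> {0}"
  proof -
    \<comment> \<open>Row \<open>i\<close> of the matrix has sum \<open>1\<close>, so it has a positive entry.\<close>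
    obtain k where k: "k \<in> \<Lambda>" "p i k > 0"
      using coeff_sum[OF i] sum_nonpos[of \<Lambda> "p i"] by force
    then have "k \<in> ?R" using i by (auto simp: step_Suc_0 intro!: exI[of _ 1])
    then have "e k \<in> span (e ` ?R)" by (intro span_base) auto
    moreover have "e k \<noteq> 0"
      using k independent_generators dependent_zero by (metis imageI)
    ultimately show ?thesis by auto
  qed
  ultimately have "j \<in> ?R"
    using generator_in_span_imp_mem[of ?R j] j by auto
  then show thesis using that by auto
qed

text \<open>Reachability both ways forces divisibility: a detour through \<open>j\<close> that uses a return time \<open>n\<close>
  of \<open>j\<close>, and the same detour without it, are both return times of \<open>i\<close>, and they differ by \<open>n\<close>.\<close>

lemma communicating_period_dvd:
  assumes ij: "i \<in> \<Lambda>" "j \<in> \<Lambda>"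
    and a: "a \<ge> 1" "step a i j > 0" and b: "b \<ge> 1" "step b j i > 0"
  shows "generator_period m \<Lambda> e i dvd generator_period m \<Lambda> e j"
  unfolding generator_period_def[of m \<Lambda> e j]
proof (rule Gcd_greatest)
  fix n assume "n \<in> {n. 1 \<le> n \<and> step n j j > 0}"
  then have n: "step n j j > 0" by simp
  have return: "generator_period m \<Lambda> e i dvd k" if "1 \<le> k" "step k i i > 0" for k
    unfolding generator_period_def using that by (intro Gcd_dvd) simp
  have "generator_period m \<Lambda> e i dvd a + b"
    using step_pos_trans[OF ij(1,2,1) a(2) b(2)] a(1) by (intro return) auto
  moreover have "generator_period m \<Lambda> e i dvd (a + b) + n"
    using step_pos_trans[OF ij(1,2,1) step_pos_trans[OF ij(1,2,2) a(2) n] b(2)] a(1)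
    by (intro return) (auto simp: ac_simps)
  ultimately show "generator_period m \<Lambda> e i dvd n"
    by (simp add: dvd_add_right_iff)
qed

lemma simple_imp_equal_periods:
  assumes simple: "simple_evolution_algebra m \<Lambda> e"
    and "i \<in> \<Lambda>" "j \<in> \<Lambda>"
  shows "generator_period m \<Lambda> e i = generator_period m \<Lambda> e j"
proof -
  obtain a where "a \<ge> 1" "step a i j > 0"
    using simple_imp_reachable assms by blast
  moreover obtain b where "b \<ge> 1" "step b j i > 0"
    using simple_imp_reachable assms by blast
  ultimately show ?thesis
    using assms by (intro dvd_antisym communicating_period_dvd)
qed

end

theorem theorem2p28:
  fixes m :: "'a::real_vector \<Rightarrow> 'a \<Rightarrow> 'a"
    and \<Lambda> :: "'i set"
    and e :: "'i \<Rightarrow> 'a"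
    and p :: "'i \<Rightarrow> 'i \<Rightarrow> real"
  assumes "markov_evolution_algebra m \<Lambda> e p"
    and "simple_evolution_algebra m \<Lambda> e"
  shows "(\<exists>d. \<forall>j\<in>\<Lambda>. periodic_generator m \<Lambda> e j \<and> generator_period m \<Lambda> e j = d) \<or>
         (\<forall>j\<in>\<Lambda>. aperiodic_generator m \<Lambda> e j)"
proof -
  interpret markov_evolution_algebra m \<Lambda> e p by fact
  obtain i where "i \<in> \<Lambda>" using nonempty_index by auto
  then have "\<forall>j\<in>\<Lambda>. generator_period m \<Lambda> e j = generator_period m \<Lambda> e i"
    using simple_imp_equal_periods assms(2) by blast
  then show ?thesis
    by (cases "generator_period m \<Lambda> e i = 1")
      (auto simp: periodic_generator_def aperiodic_generator_def)
qed

end
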